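(* For every integer $n\ge0$, \[ |\Phi_n(0)|^2=|\Phi_n(\pi)|^2=\frac{\Gamma(\tfrac14)^2}{\pi^2\sqrt2}\left(n+\frac14\right)\frac{\Gamma(n+\tfrac12)}{\Gamma(n+1)} . \] In particular, there exist constants $0<c<C<\infty$ such that \[ c(n+1)^{1/2}\le|\Phi_n(0)|^2+|\Phi_n(\pi)|^2\le C(n+1)^{1/2}\qquad\text{for all }n\ge0 . \]
   Context: $C_n^{1/4}$ is the Gegenbauer polynomial of degree $n$ and parameter $1/4$, and for $\varphi\in[0,\pi]$, $\Phi_n(\varphi)=\mathfrak h_n^{-1/2}C_n^{1/4}(\cos\varphi)$ with $\mathfrak h_n=\dfrac{\pi\sqrt2\,\Gamma(n+\frac12)}{\Gamma(n+1)(n+\frac14)\Gamma(\frac14)^2}$. *)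

theory Defs
  imports "HOL-Analysis.Analysis"
begin

text \<open>
  The Gegenbauer (ultraspherical) polynomials in their standard normalization, given by the
  three-term recurrence
  \<open>(n + 2) C\<^sub>n\<^sub>+\<^sub>2(x) = 2 (n + 1 + a) x C\<^sub>n\<^sub>+\<^sub>1(x) - (n + 2 a) C\<^sub>n(x)\<close>.
  The lemma \<open>gegenbauer_gen_fun\<close> below ties them to the generating function
  \<open>(1 - 2 x t + t\<^sup>2) powr (-a) = (\<Sum>n. C\<^sub>n(x) t ^ n)\<close>.
\<close>

fun gegenbauer :: "real \<Rightarrow> nat \<Rightarrow> real poly" where
  "gegenbauer a 0 = 1"
| "gegenbauer a (Suc 0) = [:0, 2 * a:]"
| "gegenbauer a (Suc (Suc n)) =
     smult (2 * (real n + 1 + a) / (real n + 2)) ([:0, 1:] * gegenbauer a (Suc n))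
     - smult ((real n + 2 * a) / (real n + 2)) (gegenbauer a n)"

lemma degree_gegenbauer:
  assumes "a > 0"
  shows "degree (gegenbauer a n) = n"
proof -
  have "degree (gegenbauer a n) = n \<and> gegenbauer a n \<noteq> 0"
    using assms
  proof (induction a n rule: gegenbauer.induct)
    case (3 a n)
    let ?p = "smult (2 * (real n + 1 + a) / (real n + 2)) ([:0, 1:] * gegenbauer a (Suc n))"
    let ?q = "smult ((real n + 2 * a) / (real n + 2)) (gegenbauer a n)"
    have "real n + 1 + a \<noteq> 0" "real n + 2 \<noteq> 0"
      using 3 by linarith+
    then have p: "degree ?p = Suc (Suc n)"
      using 3 by (simp add: degree_mult_eq del: mult_pCons_left)
    have q: "degree ?q \<le> n"
      using 3 by simp
    have "degree (?p - ?q) = degree ?p"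
      using p q degree_add_eq_left[of "- ?q" ?p] by simp
    then have "degree (gegenbauer a (Suc (Suc n))) = Suc (Suc n)"
      using p by simp
    then show ?case by (metis degree_0 nat.distinct(1))
  qed auto
  then show ?thesis by simp
qed

lemma gegenbauer_gen_fun:
  fixes a x :: real
  shows "Abs_fps (\<lambda>n. poly (gegenbauer a n) x)
       = fps_binomial (- a) oo (fps_X ^ 2 - fps_const (2 * x) * fps_X)"
proof -
  define u where "u = fps_X ^ 2 - fps_const (2 * x) * (fps_X :: real fps)"
  define G where "G = fps_binomial (- a) oo u"
  have u0 [simp]: "fps_nth u 0 = 0" by (simp add: u_def)
  have du: "fps_deriv u = fps_const 2 * (fps_X - fps_const x)"
    by (simp add: u_def power2_eq_square algebra_simps numeral_fps_const flip: fps_const_mult)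
  have "(1 + fps_X) * fps_deriv (fps_binomial (- a)) = fps_const (- a) * fps_binomial (- a)"
    by (simp add: fps_binomial_deriv fps_divide_unit mult.assoc [symmetric])
       (simp add: mult.commute mult.left_commute inverse_mult_eq_1')
  then have "((1 + fps_X) * fps_deriv (fps_binomial (- a))) oo u
           = (fps_const (- a) * fps_binomial (- a)) oo u"
    by simp
  then have "(1 + u) * (fps_deriv (fps_binomial (- a)) oo u) = fps_const (- a) * G"
    by (simp add: fps_compose_mult_distrib fps_compose_add_distrib G_def
             del: fps_const_neg)
  then have ode: "(1 + u) * fps_deriv G = fps_const (- a) * G * fps_deriv u"
    by (simp add: G_def fps_compose_deriv mult.assoc [symmetric] del: fps_const_neg)
  have G0: "fps_nth G 0 = 1" by (simp add: G_def)
  have G1: "fps_nth G (Suc 0) = 2 * a * x"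
    using arg_cong[OF ode, of "\<lambda>f. fps_nth f 0"] by (simp add: du G0)
  have rec: "(real n + 2) * fps_nth G (Suc (Suc n))
           = 2 * (real n + 1 + a) * x * fps_nth G (Suc n) - (real n + 2 * a) * fps_nth G n" for n
  proof -
    have l: "(1 + u) * fps_deriv G
        = fps_deriv G + fps_X * (fps_X * fps_deriv G) - fps_const (2 * x) * (fps_X * fps_deriv G)"
      by (simp add: u_def power2_eq_square algebra_simps)
    have r: "fps_const (- a) * G * fps_deriv u
        = fps_const (2 * a * x) * G - fps_const (2 * a) * (fps_X * G)"
      unfolding du
      by (rule fps_ext) (simp add: algebra_simps flip: fps_const_mult fps_const_neg)
    have "fps_nth (fps_deriv G + fps_X * (fps_X * fps_deriv G)
            - fps_const (2 * x) * (fps_X * fps_deriv G)) (Suc n)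
        = fps_nth (fps_const (2 * a * x) * G - fps_const (2 * a) * (fps_X * G)) (Suc n)"
      using ode unfolding l r by simp
    then show ?thesis
      by (cases n) (simp_all add: algebra_simps)
  qed
  have "poly (gegenbauer a n) x = fps_nth G n" for n
  proof (induction n rule: induct_nat_012)
    case (ge2 n)
    have "(real n + 2) * poly (gegenbauer a (Suc (Suc n))) x
        = 2 * (real n + 1 + a) * x * fps_nth G (Suc n) - (real n + 2 * a) * fps_nth G n"
      using ge2 by (simp add: right_diff_distrib)
    then have "(real n + 2) * poly (gegenbauer a (Suc (Suc n))) x = (real n + 2) * fps_nth G (Suc (Suc n))"
      by (simp only: rec)
    then show ?case
      by (metis add_pos_nonneg add.commute mult_cancel_left of_nat_0_le_iff less_irrefl zero_less_numeral)
  qed (simp_all add: G0 G1)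
  then show ?thesis by (simp add: fps_ext G_def u_def)
qed

text \<open>The squared norm of \<open>C\<^sub>n(cos \<phi>)\<close>, with parameter \<open>a = 1 / 4\<close>, in \<open>L\<^sup>2([0, pi], sqrt (sin \<phi>) d\<phi>)\<close>.\<close>

definition hnorm :: "nat \<Rightarrow> real" where
  "hnorm n = pi * sqrt 2 * Gamma (real n + 1/2)
     / (Gamma (real n + 1) * (real n + 1/4) * Gamma (1/4) ^ 2)"

definition Phi :: "nat \<Rightarrow> real \<Rightarrow> real" where
  "Phi n \<phi> = hnorm n powr (- 1/2) * poly (gegenbauer (1/4) n) (cos \<phi>)"

end

theory Submission
  imports Defs
begin

text \<open>
  At the endpoints \<open>x = 1\<close> and \<open>x = -1\<close> the three-term recurrence of the Gegenbauer polynomials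
  degenerates: at \<open>x = 1\<close> it factors through the first-order recurrence
  \<open>(n + 1) C\<^sub>n\<^sub>+\<^sub>1(1) = (n + 2 a) C\<^sub>n(1)\<close>, so that \<open>C\<^sub>n(1) = pochhammer (2 a) n / n!\<close> (\<open>gegenbauer_one\<close>),
  and \<open>C\<^sub>n\<close> has the parity of \<open>n\<close>, so that \<open>x = -1\<close> gives the same absolute value.

  For \<open>a = 1/4\<close> the value is \<open>w\<^sub>n = pochhammer (1/2) n / n! = Gamma (n + 1/2) / (sqrt pi Gamma (n + 1))\<close>.
  The norm \<open>hnorm n\<close> contains the same Gamma quotient to the first power,
  so \<open>w\<^sub>n\<^sup>2 / hnorm n\<close> retains exactly one factor of it; this is the closed form (\<open>Phi_zero_squared\<close>).
  The growth rate then comes from \<open>1 / (4 n + 1) \<le> w\<^sub>n\<^sup>2 \<le> 1 / (2 n + 1)\<close> (\<open>pochhammer_half_bounds\<close>): here \<open>w\<^sub>n\<close> has order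
  \<open>n powr (-1/2)\<close>, while the factor \<open>n + 1/4\<close> has order \<open>n\<close>.
\<close>

lemma poly_gegenbauer_minus:
  "poly (gegenbauer a n) (- x) = (- 1) ^ n * poly (gegenbauer a n) x"
  by (induction a n rule: gegenbauer.induct) (simp_all add: algebra_simps)

text \<open>
  At \<open>x = 1\<close> the coefficient \<open>2 (n + 1 + a)\<close> is \<open>(n + 1) + (n + 1 + 2 a)\<close>, so the defining recurrence
  says that \<open>(n + 1) C\<^sub>n\<^sub>+\<^sub>1(1) - (n + 2 a) C\<^sub>n(1)\<close> does not depend on \<open>n\<close>; it vanishes for \<open>n = 0\<close>.
\<close>

lemma gegenbauer_one_Suc:
  "(real n + 1) * poly (gegenbauer a (Suc n)) 1 = (real n + 2 * a) * poly (gegenbauer a n) 1"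
proof (induction n)
  case 0
  show ?case by simp
next
  case (Suc n)
  have "(real n + 2) * poly (gegenbauer a (Suc (Suc n))) 1
      = 2 * (real n + 1 + a) * poly (gegenbauer a (Suc n)) 1
        - (real n + 2 * a) * poly (gegenbauer a n) 1"
    by (simp add: right_diff_distrib)
  also have "\<dots> = (real n + 1 + 2 * a) * poly (gegenbauer a (Suc n)) 1"
    unfolding Suc.IH[symmetric] by (simp add: algebra_simps)
  finally show ?case by (simp add: algebra_simps)
qed

lemma gegenbauer_one: "poly (gegenbauer a n) 1 = pochhammer (2 * a) n / fact n"
proof (induction n)
  case 0
  show ?case by simp
next
  case (Suc n)
  have "poly (gegenbauer a (Suc n)) 1 = (real n + 2 * a) * poly (gegenbauer a n) 1 / (real n + 1)"
    using gegenbauer_one_Suc[of n a] by (simp add: field_simps)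
  then show ?case
    by (simp add: Suc.IH pochhammer_rec' add_ac mult_ac)
qed

lemma pochhammer_half_Gamma:
  "pochhammer (1/2) n / fact n = Gamma (real n + 1/2) / (sqrt pi * Gamma (real n + 1))"
proof -
  have "(1/2 :: real) \<notin> \<int>\<^sub>\<le>\<^sub>0"
    by (auto elim!: nonpos_Ints_cases)
  then show ?thesis
    by (simp add: pochhammer_Gamma Gamma_one_half_real Gamma_fact add_ac)
qed

text \<open>
  These are the Wallis-type bounds for the central binomial ratio \<open>binomial (2 n) n / 4 ^ n\<close>.
  Both are equalities at \<open>n = 0\<close>, and a step multiplies \<open>w\<^sup>2\<close> by \<open>((2 n + 1) / (2 n + 2))\<^sup>2\<close>,
  which lies between the quotients \<open>(4 n + 1) / (4 n + 5)\<close> and \<open>(2 n + 1) / (2 n + 3)\<close> of consecutive bounds.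
\<close>

lemma pochhammer_half_bounds:
  fixes n :: nat
  defines "w \<equiv> pochhammer (1/2) n / fact n :: real"
  shows "1 / (4 * real n + 1) \<le> w\<^sup>2" and "w\<^sup>2 \<le> 1 / (2 * real n + 1)"
proof -
  define v where "v n = (pochhammer (1/2) n / fact n :: real)\<^sup>2" for n
  have "1 / (4 * real n + 1) \<le> v n \<and> v n \<le> 1 / (2 * real n + 1)"
  proof (induction n)
    case 0
    show ?case by (simp add: v_def)
  next
    case (Suc n)
    define s where "s = ((2 * real n + 1) / (2 * real n + 2))\<^sup>2"
    have "pochhammer (1/2) (Suc n) / fact (Suc n)
        = (2 * real n + 1) / (2 * real n + 2) * (pochhammer (1/2) n / fact n :: real)"
      by (simp add: pochhammer_rec' divide_simps) (simp add: algebra_simps)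
    then have step: "v (Suc n) = s * v n"
      by (simp only: v_def s_def power_mult_distrib)
    have s0: "0 \<le> s" by (simp add: s_def)
    have "(2 * real n + 2)\<^sup>2 * (4 * real n + 1) \<le> (2 * real n + 1)\<^sup>2 * (4 * real n + 5)"
      by (simp add: power2_eq_square algebra_simps)
    then have "1 / (4 * real (Suc n) + 1)
        \<le> (2 * real n + 1)\<^sup>2 / ((2 * real n + 2)\<^sup>2 * (4 * real n + 1))"
      by (subst pos_le_divide_eq) (simp_all add: pos_divide_le_eq add_ac zero_less_mult_iff)
    also have "\<dots> = s * (1 / (4 * real n + 1))"
      by (simp add: s_def power_divide)
    also have "\<dots> \<le> v (Suc n)"
      unfolding step using Suc.IH s0 by (intro mult_left_mono) auto
    finally have lower: "1 / (4 * real (Suc n) + 1) \<le> v (Suc n)" .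
    have "v (Suc n) \<le> s * (1 / (2 * real n + 1))"
      unfolding step using Suc.IH s0 by (intro mult_left_mono) auto
    also have "\<dots> = (2 * real n + 1) / (2 * real n + 2)\<^sup>2"
      by (simp add: s_def power2_eq_square)
    also have "\<dots> \<le> 1 / (2 * real (Suc n) + 1)"
      by (simp add: divide_simps power2_eq_square add_pos_nonneg) (simp add: algebra_simps)
    finally show ?case using lower by simp
  qed
  then show "1 / (4 * real n + 1) \<le> w\<^sup>2" "w\<^sup>2 \<le> 1 / (2 * real n + 1)"
    by (simp_all add: v_def w_def)
qed

lemma pochhammer_half_scaled_bounds:
  fixes n :: nat
  defines "w \<equiv> pochhammer (1/2) n / fact n :: real"
  shows "sqrt (real n + 1) / 4 \<le> (real n + 1/4) * w" and "(real n + 1/4) * w \<le> sqrt (real n + 1)"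
proof -
  have w0: "0 \<le> w"
    by (simp add: w_def pochhammer_nonneg)
  note b = pochhammer_half_bounds[of n, folded w_def]
  have "(sqrt (real n + 1) / 4)\<^sup>2 = (real n + 1) / 16"
    by (simp add: power_divide)
  also have "\<dots> \<le> (real n + 1/4)\<^sup>2 * (1 / (4 * real n + 1))"
    by (simp add: divide_simps power2_eq_square) (simp add: algebra_simps)
  also have "\<dots> \<le> ((real n + 1/4) * w)\<^sup>2"
    unfolding power_mult_distrib by (intro mult_left_mono b) auto
  finally show "sqrt (real n + 1) / 4 \<le> (real n + 1/4) * w"
    by (rule power2_le_imp_le) (use w0 in simp)
  have "((real n + 1/4) * w)\<^sup>2 \<le> (real n + 1/4)\<^sup>2 * (1 / (2 * real n + 1))"
    unfolding power_mult_distrib by (intro mult_left_mono b) auto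
  also have "\<dots> \<le> real n + 1"
    by (simp add: divide_simps power2_eq_square) (simp add: algebra_simps)
  finally show "(real n + 1/4) * w \<le> sqrt (real n + 1)"
    by (rule real_le_rsqrt)
qed

lemma Phi_zero_squared:
  "\<bar>Phi n 0\<bar>\<^sup>2 = Gamma (1/4 :: real) ^ 2 / (pi ^ 2 * sqrt 2) * (real n + 1/4)
      * (Gamma (real n + 1/2) / Gamma (real n + 1))"
proof -
  have pos: "Gamma (real n + 1/2) > 0" "Gamma (real n + 1) > 0" "Gamma (1/4 :: real) > 0"
    by (auto intro!: Gamma_real_pos add_nonneg_pos)
  have h: "hnorm n > 0"
    unfolding hnorm_def by (intro divide_pos_pos mult_pos_pos zero_less_power pos) auto
  have "(hnorm n powr (- 1/2))\<^sup>2 = inverse (hnorm n)"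
    using h by (simp add: powr_minus powr_half_sqrt power_inverse)
  then have "\<bar>Phi n 0\<bar>\<^sup>2
      = inverse (hnorm n) * (Gamma (real n + 1/2) / (sqrt pi * Gamma (real n + 1)))\<^sup>2"
    by (simp add: Phi_def power_mult_distrib power_divide gegenbauer_one flip: pochhammer_half_Gamma)
  also have "\<dots> = Gamma (1/4 :: real) ^ 2 / (pi ^ 2 * sqrt 2) * (real n + 1/4)
      * (Gamma (real n + 1/2) / Gamma (real n + 1))"
    using pos[THEN less_imp_neq, symmetric] by (simp add: hnorm_def power_mult_distrib power_divide)
      (simp add: field_simps power2_eq_square)
  finally show ?thesis .
qed

lemma Phi_pi_squared: "\<bar>Phi n pi\<bar>\<^sup>2 = \<bar>Phi n 0\<bar>\<^sup>2"
  using poly_gegenbauer_minus[of "1/4" n 1] by (simp add: Phi_def abs_mult power_abs)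

theorem proposition5p1:
  shows "(\<forall>n::nat.
            \<bar>Phi n 0\<bar>\<^sup>2 = \<bar>Phi n pi\<bar>\<^sup>2 \<and>
            \<bar>Phi n pi\<bar>\<^sup>2 =
              Gamma (1/4 :: real) ^ 2 / (pi ^ 2 * sqrt 2) * (real n + 1/4)
                * (Gamma (real n + 1/2) / Gamma (real n + 1)))
       \<and> (\<exists>c C :: real. 0 < c \<and> c < C \<and>
            (\<forall>n::nat.
               c * (real n + 1) powr (1/2) \<le> \<bar>Phi n 0\<bar>\<^sup>2 + \<bar>Phi n pi\<bar>\<^sup>2 \<and>
               \<bar>Phi n 0\<bar>\<^sup>2 + \<bar>Phi n pi\<bar>\<^sup>2 \<le> C * (real n + 1) powr (1/2)))"
proof (intro conjI)
  show "\<forall>n::nat.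
            \<bar>Phi n 0\<bar>\<^sup>2 = \<bar>Phi n pi\<bar>\<^sup>2 \<and>
            \<bar>Phi n pi\<bar>\<^sup>2 =
              Gamma (1/4 :: real) ^ 2 / (pi ^ 2 * sqrt 2) * (real n + 1/4)
                * (Gamma (real n + 1/2) / Gamma (real n + 1))"
    by (simp only: Phi_pi_squared Phi_zero_squared simp_thms)
next
  \<comment> \<open>\<open>K\<close> collects the constants of both endpoint terms; \<open>sqrt pi\<close> is what separates
      the Gamma quotient from \<open>pochhammer (1/2) n / n!\<close>.\<close>
  define K where "K = 2 * (Gamma (1/4 :: real) ^ 2 / (pi ^ 2 * sqrt 2)) * sqrt pi"
  have K: "K > 0"
    unfolding K_def
    by (intro mult_pos_pos divide_pos_pos zero_less_power Gamma_real_pos) auto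
  have total: "\<bar>Phi n 0\<bar>\<^sup>2 + \<bar>Phi n pi\<bar>\<^sup>2 = K * ((real n + 1/4) * (pochhammer (1/2) n / fact n))"
    for n
    unfolding Phi_pi_squared Phi_zero_squared pochhammer_half_Gamma K_def by (simp add: mult_ac)
  have "K / 4 * (real n + 1) powr (1/2) \<le> \<bar>Phi n 0\<bar>\<^sup>2 + \<bar>Phi n pi\<bar>\<^sup>2" for n
    using mult_left_mono[OF pochhammer_half_scaled_bounds(1)[of n], of K] K
    unfolding total by (simp add: powr_half_sqrt)
  moreover have "\<bar>Phi n 0\<bar>\<^sup>2 + \<bar>Phi n pi\<bar>\<^sup>2 \<le> K * (real n + 1) powr (1/2)" for n
    using mult_left_mono[OF pochhammer_half_scaled_bounds(2)[of n], of K] K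
    unfolding total by (simp add: powr_half_sqrt)
  ultimately show "\<exists>c C :: real. 0 < c \<and> c < C \<and>
            (\<forall>n::nat.
               c * (real n + 1) powr (1/2) \<le> \<bar>Phi n 0\<bar>\<^sup>2 + \<bar>Phi n pi\<bar>\<^sup>2 \<and>
               \<bar>Phi n 0\<bar>\<^sup>2 + \<bar>Phi n pi\<bar>\<^sup>2 \<le> C * (real n + 1) powr (1/2))"
    using K by (intro exI[of _ "K / 4"] exI[of _ K]) auto
qed

end
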